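(* Let $0<p<1$, $q=1-p$ and $t\in\mathbb R$. For every integer $k\ge1$, $$\widetilde A_k(t;p)-\widetilde A_k(-t;q)=\frac{\Xi_k(p)\,t^k}{k}.$$ Moreover, for every integer $N\ge1$ with $|t|<Np$ and $|t|<Nq$, putting $m=Np+t$ (so $N-m=Nq-t$), $$\sum_{k\ge1}\frac{\Xi_k(p)\,t^k}{k\,N^k}=\log\frac{q\,m}{p\,(N-m)},$$ where $\dfrac{q\,m}{p\,(N-m)}=\dfrac{Nq/(N-m)}{Np/m}$ is the ratio of the two size-bias prefactors $Nq/(N-m)$ and $Np/m$.
   Context: $B_n(t)$ are the Bernoulli polynomials, $\sum_{n\ge0}B_n(t)z^n/n!=\frac{z}{e^z-1}e^{tz}$, and $B_n=B_n(0)$ (so $B_1=-\tfrac12$). For $0<p<1$, $q=1-p$ and $k\ge1$, $$\Xi_k(p)=\frac{(-1)^{k+1}}{p^k}+\frac1{q^k},\qquad \widetilde A_k(t;p)=\frac{(-1)^{k+1}B_{k+1}-\Xi_k(p)B_{k+1}(t)}{k(k+1)};$$ in $\widetilde A_k(-t;q)$ the roles of $p$ and $q$ are interchanged, so $\Xi_k(q)=\frac{(-1)^{k+1}}{q^k}+\frac1{p^k}$. *)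

theory Defs
  imports "HOL-Analysis.Analysis" "HOL-Computational_Algebra.Formal_Power_Series"
begin

definition bernoulli_egf :: "real \<Rightarrow> real fps" where
  "bernoulli_egf t = fps_X / (fps_exp 1 - 1) * fps_exp t"

text \<open>
  Although the denominator \<open>fps_exp 1 - 1\<close> has zero constant coefficient, the division of formal
  power series is exact here, since numerator and denominator both have subdegree 1.
\<close>

lemma bernoulli_egf_mult: "bernoulli_egf t * (fps_exp 1 - 1) = fps_X * fps_exp t"
proof -
  have "fps_exp 1 - 1 \<noteq> (0 :: real fps)"
    by simp
  moreover have "subdegree (fps_exp 1 - 1 :: real fps) = 1"
    by (rule subdegreeI) auto
  ultimately have "(fps_exp 1 - 1 :: real fps) dvd fps_X"
    by (simp add: fps_dvd_iff)
  then have "fps_X / (fps_exp 1 - 1) * (fps_exp 1 - 1) = (fps_X :: real fps)"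
    by simp
  then show ?thesis
    by (simp add: bernoulli_egf_def mult.assoc mult.commute mult.left_commute)
qed

definition bernpoly :: "nat \<Rightarrow> real \<Rightarrow> real" where
  "bernpoly n t = fact n * fps_nth (bernoulli_egf t) n"

text \<open>The convention of the Bernoulli numbers is the one with \<open>bernoulli 1 = - 1 / 2\<close>.\<close>

definition bernoulli :: "nat \<Rightarrow> real" where
  "bernoulli n = bernpoly n 0"

definition Xi :: "nat \<Rightarrow> real \<Rightarrow> real" where
  "Xi k p = (-1) ^ (k + 1) / p ^ k + 1 / (1 - p) ^ k"

definition A_tilde :: "nat \<Rightarrow> real \<Rightarrow> real \<Rightarrow> real" where
  "A_tilde k t p =
     ((-1) ^ (k + 1) * bernoulli (k + 1) - Xi k p * bernpoly (k + 1) t) / (real k * real (k + 1))"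

end

theory Submission
  imports Defs
begin

text \<open>
  Since \<^prop>\<open>Xi k (1 - p) = (-1) ^ (k + 1) * Xi k p\<close>, the first part reduces to
  \<open>(-1)\<^sup>n B\<^sub>n(-t) = B\<^sub>n(1 + t) = B\<^sub>n(t) + n t\<^bsup>n-1\<^esup>\<close>, read off from the generating function after
  replacing \<open>z\<close> by \<open>-z\<close>. For the second, the two summands of \<open>Xi\<close> give the Mercator series
  of \<open>ln (1 + t / (N p))\<close> and \<open>- ln (1 - t / (N q))\<close>.
\<close>

lemma bernoulli_egf_reflect:
  "bernoulli_egf (- t) oo (- fps_X) = bernoulli_egf t + fps_X * fps_exp t"
proof -
  let ?E = "fps_exp 1 :: real fps"
  let ?G = "bernoulli_egf (- t) oo (- fps_X)"
  have exp_uminus: "fps_exp c oo (- fps_X) = fps_exp (- c)" for c :: real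
    by (simp add: fps_compose_uminus' fps_eq_iff power_mult_distrib [symmetric])
  have "(bernoulli_egf (- t) * (?E - 1)) oo (- fps_X) = (fps_X * fps_exp (- t)) oo (- fps_X)"
    by (simp add: bernoulli_egf_mult)
  then have G: "?G * (fps_exp (- 1) - 1) = - fps_X * fps_exp t"
    by (simp add: fps_compose_mult_distrib fps_compose_sub_distrib exp_uminus)
  have inv: "fps_exp (- 1) * ?E = 1"
    by (simp flip: fps_exp_add_mult)
  \<comment> \<open>Multiplying \<open>fps_exp (- 1) - 1\<close> by \<open>- ?E\<close> gives
    \<open>?E - 1\<close>. Both sides of the goal can thus be compared after multiplication by this
    nonzero series, which cancels at the end.\<close>
  have "?G * (?E - 1) = - (?G * (fps_exp (- 1) - 1)) * ?E"
    using inv by (simp add: algebra_simps)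
  also have "\<dots> = fps_X * fps_exp t * ?E"
    by (simp add: G)
  also have "\<dots> = (bernoulli_egf t + fps_X * fps_exp t) * (?E - 1)"
    unfolding distrib_right bernoulli_egf_mult by (simp add: algebra_simps)
  finally show ?thesis
    by simp
qed

text \<open>Coefficient comparison in \<open>bernoulli_egf_reflect\<close>. At index
  \<open>Suc n\<close> the summand \<open>fps_X * fps_exp t\<close> contributes
  \<open>t ^ n / fact n\<close>, with no truncated \<open>n - 1\<close>, and
  \<open>fact (Suc n) / fact n\<close> leaves the factor \<open>Suc n\<close>.\<close>

lemma bernpoly_reflect:
  "(-1) ^ Suc n * bernpoly (Suc n) (- t) = bernpoly (Suc n) t + real (Suc n) * t ^ n"
proof -
  have "(-1) ^ Suc n * fps_nth (bernoulli_egf (- t)) (Suc n) =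
      fps_nth (bernoulli_egf t) (Suc n) + t ^ n / fact n"
    using arg_cong [OF bernoulli_egf_reflect, of "\<lambda>f. fps_nth f (Suc n)" t]
    by (simp add: fps_compose_uminus')
  then have "(-1) ^ Suc n * bernpoly (Suc n) (- t) =
      fact (Suc n) * (fps_nth (bernoulli_egf t) (Suc n) + t ^ n / fact n)"
    unfolding bernpoly_def by (metis mult.left_commute)
  also have "\<dots> = bernpoly (Suc n) t + real (Suc n) * t ^ n"
    by (simp add: bernpoly_def distrib_left fact_Suc del: of_nat_Suc)
  finally show ?thesis .
qed

text \<open>The sign squares to 1, so multiplying by it moves it from one summand to the
  other.\<close>

lemma Xi_swap: "Xi k (1 - p) = (-1) ^ (k + 1) * Xi k p"
  by (simp add: Xi_def algebra_simps flip: power_mult_distrib)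

lemma A_tilde_diff:
  assumes "k \<ge> 1"
  shows "A_tilde k t p - A_tilde k (- t) (1 - p) = Xi k p * t ^ k / real k"
proof -
  have "Xi k (1 - p) * bernpoly (k + 1) (- t) =
      Xi k p * ((-1) ^ Suc k * bernpoly (Suc k) (- t))"
    by (simp add: Xi_swap)
  also have "\<dots> = Xi k p * (bernpoly (k + 1) t + real (k + 1) * t ^ k)"
    by (simp only: bernpoly_reflect flip: Suc_eq_plus1)
  \<comment> \<open>The Bernoulli number term depends on neither \<open>t\<close> nor
    \<open>p\<close> and cancels, as do the two copies of
    \<open>Xi k p * bernpoly (k + 1) t\<close>.\<close>
  finally have "A_tilde k t p - A_tilde k (- t) (1 - p) =
      Xi k p * (real (k + 1) * t ^ k) / (real k * real (k + 1))"
    unfolding A_tilde_def diff_divide_distrib [symmetric] by (simp add: algebra_simps)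
  then show ?thesis
    using assms by (simp add: field_simps del: of_nat_Suc)
qed

lemma mercator_sums:
  fixes x :: real
  assumes "\<bar>x\<bar> < 1"
  shows "(\<lambda>j. (-1) ^ j * x ^ (j + 1) / real (j + 1)) sums ln (1 + x)"
proof -
  have eq: "- ((- x) ^ Suc j) / real (Suc j) = (-1) ^ j * x ^ (j + 1) / real (j + 1)" for j
    by (simp add: power_minus [of x])
  \<comment> \<open>\<open>ln_series'\<close> starts at index 0, where division by
    \<open>real 0\<close> makes the term 0; the shift therefore keeps the sum.\<close>
  have "(\<lambda>j. - ((- x) ^ Suc j) / real (Suc j)) sums ln (1 + x)"
    using ln_series' [OF assms] by (subst sums_Suc_iff) simp
  then show ?thesis
    by (simp only: eq)
qed

lemma Xi_sums:
  assumes "0 < p" "p < 1" "\<bar>t\<bar> < c * p" "\<bar>t\<bar> < c * (1 - p)"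
  shows "(\<lambda>j. Xi (j + 1) p * t ^ (j + 1) / (real (j + 1) * c ^ (j + 1)))
    sums ln ((1 - p) * (c * p + t) / (p * (c * (1 - p) - t)))"
proof -
  define q where "q = 1 - p"
  define x where "x = t / (c * p)"
  define y where "y = t / (c * q)"
  have q: "0 < q" "1 - p = q" and t: "\<bar>t\<bar> < c * q"
    using assms by (auto simp: q_def)
  have c: "0 < c"
    using assms by (metis abs_ge_zero order_le_less_trans zero_less_mult_pos2)
  have xy: "\<bar>x\<bar> < 1" "\<bar>y\<bar> < 1"
    using assms c q t by (auto simp: x_def y_def abs_mult)
  have "(\<lambda>j. (-1) ^ j * x ^ (j + 1) / real (j + 1) -
      (-1) ^ j * (- y) ^ (j + 1) / real (j + 1)) sums (ln (1 + x) - ln (1 + (- y)))"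
    using xy by (intro sums_diff mercator_sums) auto
  moreover have "(-1) ^ j * x ^ (j + 1) / real (j + 1) - (-1) ^ j * (- y) ^ (j + 1) / real (j + 1) =
      Xi (j + 1) p * t ^ (j + 1) / (real (j + 1) * c ^ (j + 1))" for j
  proof -
    \<comment> \<open>The series at \<open>- y\<close> has terms of constant sign pattern in
      \<open>y\<close>, as the summand \<open>1 / (1 - p) ^ k\<close> of \<open>Xi\<close> requires.
      In the other summand, \<open>k = j + 1\<close> gives the sign
      \<open>(-1) ^ (j + 2) = (-1) ^ j\<close>.\<close>
    have "(-1) ^ j * (- y) ^ (j + 1) = - (y ^ (j + 1))"
      by (simp flip: power_mult_distrib)
    then have "(-1) ^ j * x ^ (j + 1) / real (j + 1) - (-1) ^ j * (- y) ^ (j + 1) / real (j + 1) =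
        ((-1) ^ j * x ^ (j + 1) + y ^ (j + 1)) / real (j + 1)"
      by (simp only: diff_divide_distrib [symmetric]) simp
    also have "(-1) ^ j * x ^ (j + 1) + y ^ (j + 1) = Xi (j + 1) p * t ^ (j + 1) / c ^ (j + 1)"
      unfolding Xi_def q(2) using assms(1) c q(1)
      by (simp add: x_def y_def power_divide power_mult_distrib field_simps)
    finally show ?thesis
      by (simp add: mult.commute)
  qed
  moreover have "ln (1 + x) - ln (1 + (- y)) = ln ((1 - p) * (c * p + t) / (p * (c * (1 - p) - t)))"
  proof -
    have "ln (1 + x) - ln (1 + (- y)) = ln ((1 + x) / (1 + (- y)))"
      using xy by (subst ln_div) auto
    \<comment> \<open>Here \<open>1 + x = (c * p + t) / (c * p)\<close> and
      \<open>1 - y = (c * q - t) / (c * q)\<close>, so \<open>c\<close> cancels from the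
      prefactor.\<close>
    also have "(1 + x) / (1 + (- y)) = q * (c * p + t) / (p * (c * q - t))"
      using assms(1) c q t by (simp add: x_def y_def field_simps)
    finally show ?thesis
      by (simp add: q)
  qed
  ultimately show ?thesis
    by simp
qed

theorem proposition3p1:
  fixes p q t :: real
  assumes "0 < p" and "p < 1" and "q = 1 - p"
  shows "(\<forall>k::nat. k \<ge> 1 \<longrightarrow>
            A_tilde k t p - A_tilde k (- t) q = Xi k p * t ^ k / real k) \<and>
         (\<forall>(N::nat) (m::real).
            N \<ge> 1 \<longrightarrow> \<bar>t\<bar> < real N * p \<longrightarrow> \<bar>t\<bar> < real N * q \<longrightarrow> m = real N * p + t \<longrightarrow>
              real N - m = real N * q - t \<and>
              (\<lambda>j. Xi (j + 1) p * t ^ (j + 1) / (real (j + 1) * real N ^ (j + 1)))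
                sums ln (q * m / (p * (real N - m))) \<and>
              q * m / (p * (real N - m)) = (real N * q / (real N - m)) / (real N * p / m))"
proof (intro conjI allI impI)
  fix k :: nat
  assume "k \<ge> 1"
  then show "A_tilde k t p - A_tilde k (- t) q = Xi k p * t ^ k / real k"
    using A_tilde_diff assms(3) by simp
next
  fix N :: nat and m :: real
  assume N: "N \<ge> 1" and t: "\<bar>t\<bar> < real N * p" "\<bar>t\<bar> < real N * q" and m: "m = real N * p + t"
  show Nm: "real N - m = real N * q - t"
    by (simp add: m assms(3) algebra_simps)
  show "(\<lambda>j. Xi (j + 1) p * t ^ (j + 1) / (real (j + 1) * real N ^ (j + 1)))
      sums ln (q * m / (p * (real N - m)))"
    unfolding Nm using Xi_sums[of p t "real N"] assms t m by simp
  \<comment> \<open>The bounds give \<open>- t < real N * p\<close> and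
    \<open>t < real N * q\<close>, so the denominators can be cleared.\<close>
  have "m > 0" "real N - m > 0"
    using t m Nm by auto
  then show "q * m / (p * (real N - m)) = (real N * q / (real N - m)) / (real N * p / m)"
    using N assms(1) by (simp add: field_simps)
qed

end
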